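(* Let $\mathfrak{g}$ be a finite-dimensional real Lie algebra, let $\Pi_{\mathrm{LP}}$ be the Lie--Poisson tensor on $\mathfrak{g}^*$, let $\Phi:\mathbb{R}^+\times\mathfrak{g}^*\to\mathfrak{g}^*$, $\Phi_s(\mu)=s\mu$, be the scaling action, and let $D$ be the infinitesimal generator of $\Phi$ corresponding to $1\in\mathrm{Lie}(\mathbb{R}^+)\cong\mathbb{R}$, i.e. the vector field $D(\mu)=\mu$. Then the scaling action is conformally Poisson of degree $c=1$, that is, $$(\Phi_s)_*\,\Pi_{\mathrm{LP}}=s\,\Pi_{\mathrm{LP}}\qquad\text{for all } s\in\mathbb{R}^+.$$ Consequently, $(\mathfrak{g}^*,\Pi_{\mathrm{LP}},D)$ is an exact Poisson manifold.
   Context: $\mathbb{R}^+$ is the multiplicative group of positive reals. The Lie--Poisson tensor on $\mathfrak{g}^*$ is the bivector field $\Pi_{\mathrm{LP}}$ given at $\mu\in\mathfrak{g}^*$ by $\Pi_{\mathrm{LP},\mu}(\alpha,\beta)=\langle\mu,[\alpha,\beta]\rangle$ for $\alpha,\beta\in T_\mu^*\mathfrak{g}^*\cong\mathfrak{g}$; it is a Poisson tensor (standard fact). The pushforward of a bivector under a diffeomorphism is $((\Phi_s)_*\Pi)(\alpha,\beta)=\Pi(\Phi_s^*\alpha,\Phi_s^*\beta)$. The infinitesimal generator corresponding to $1$ is $D(\mu)=\frac{d}{dt}\big|_{t=0}\Phi_{e^t}(\mu)$. An exact Poisson manifold $(M,\Pi,D)$ is a Poisson manifold $(M,\Pi)$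 together with a vector field $D$ such that $\mathcal{L}_D\Pi=-\Pi$. *)

theory Defs
  imports "HOL-Analysis.Analysis"
begin

definition finite_dimensional :: "'v::real_vector itself \<Rightarrow> bool" where
  "finite_dimensional _ \<longleftrightarrow> (\<exists>B::'v set. finite B \<and> span B = UNIV)"

text \<open>
  The manifolds occurring here are finite-dimensional real vector spaces \<open>'v\<close>. The norm
  supplied by the type class only fixes the topology, which in finite dimension does not
  depend on the choice of norm. All tangent spaces are identified with \<open>'v\<close>, all
  cotangent spaces with \<open>'v \<Rightarrow>\<^sub>L real\<close>; in finite dimension every linear functional is
  bounded, so this is the full dual space. The class \<open>euclidean_space\<close> is not used since it
  excludes dimension zero and singles out an inner product.
\<close>

type_synonym 'v dual = "'v \<Rightarrow>\<^sub>L real"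

type_synonym 'v bivector_field = "'v \<Rightarrow> 'v dual \<Rightarrow> 'v dual \<Rightarrow> real"


subsection \<open>Smooth maps\<close>

text \<open>
  On an open subset of a finite-dimensional space, being of class \<open>C\<^sup>n\<close> is equivalent to the
  iterated directional derivatives up to order \<open>n\<close> existing and being continuous.
\<close>

primrec C_n_on :: "nat \<Rightarrow> 'a::real_normed_vector set \<Rightarrow> ('a \<Rightarrow> 'b::real_normed_vector) \<Rightarrow> bool" where
  "C_n_on 0 S f \<longleftrightarrow> continuous_on S f"
| "C_n_on (Suc n) S f \<longleftrightarrow> (\<forall>x\<in>S. f differentiable at x)
     \<and> (\<forall>v. C_n_on n S (\<lambda>x. frechet_derivative f (at x) v))"

definition smooth_on :: "'a::real_normed_vector set \<Rightarrow> ('a \<Rightarrow> 'b::real_normed_vector) \<Rightarrow> bool" where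
  "smooth_on S f \<longleftrightarrow> (\<forall>n. C_n_on n S f)"

definition differential :: "('v::real_normed_vector \<Rightarrow> real) \<Rightarrow> 'v \<Rightarrow> 'v dual" where
  "differential f x = Blinfun (frechet_derivative f (at x))"

text \<open>The covector \<open>(F\<^sup>*\<alpha>)\<^sub>x = \<alpha> \<circ> T\<^sub>x F\<close> at \<open>x\<close>, for a covector \<open>\<alpha>\<close> at \<open>F x\<close>.\<close>

definition covector_pullback ::
  "('v::real_normed_vector \<Rightarrow> 'w::real_normed_vector) \<Rightarrow> 'v \<Rightarrow> 'w dual \<Rightarrow> 'v dual" where
  "covector_pullback F x \<alpha> = \<alpha> o\<^sub>L Blinfun (frechet_derivative F (at x))"


subsection \<open>Bivector fields and Poisson manifolds\<close>

text \<open>The image at \<open>F x\<close> of the bivector \<open>P x\<close> under \<open>T\<^sub>x F\<close>.\<close>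

definition transport ::
  "('v::real_normed_vector \<Rightarrow> 'v) \<Rightarrow> 'v \<Rightarrow> 'v bivector_field \<Rightarrow> 'v dual \<Rightarrow> 'v dual \<Rightarrow> real" where
  "transport F x P \<alpha> \<beta> = P x (covector_pullback F x \<alpha>) (covector_pullback F x \<beta>)"

text \<open>Meaningful for a diffeomorphism \<open>F\<close>; the covectors \<open>\<alpha>, \<beta>\<close> below live at \<open>y\<close>.\<close>

definition pushforward ::
  "('v::real_normed_vector \<Rightarrow> 'v) \<Rightarrow> 'v bivector_field \<Rightarrow> 'v bivector_field" where
  "pushforward F P = (\<lambda>y \<alpha> \<beta>. transport F (inv F y) P \<alpha> \<beta>)"

text \<open>
  Smoothness is tested on constant covector fields, that is, on the coefficient functions of
  \<open>P\<close> with respect to linear coordinates.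
\<close>

definition smooth_bivector_field :: "'v::real_normed_vector bivector_field \<Rightarrow> bool" where
  "smooth_bivector_field P \<longleftrightarrow>
     (\<forall>x. bilinear (P x) \<and> (\<forall>\<alpha>. P x \<alpha> \<alpha> = 0)) \<and>
     (\<forall>\<alpha> \<beta>. smooth_on UNIV (\<lambda>x. P x \<alpha> \<beta>))"

definition poisson_bracket ::
  "'v::real_normed_vector bivector_field \<Rightarrow> ('v \<Rightarrow> real) \<Rightarrow> ('v \<Rightarrow> real) \<Rightarrow> 'v \<Rightarrow> real" where
  "poisson_bracket P f g = (\<lambda>x. P x (differential f x) (differential g x))"

definition poisson_manifold :: "'v::real_normed_vector bivector_field \<Rightarrow> bool" where
  "poisson_manifold P \<longleftrightarrow>
     finite_dimensional TYPE('v) \<and> smooth_bivector_field P \<and>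
     (\<forall>f g h. smooth_on UNIV f \<longrightarrow> smooth_on UNIV g \<longrightarrow> smooth_on UNIV h \<longrightarrow>
        (\<forall>x. poisson_bracket P f (poisson_bracket P g h) x
           + poisson_bracket P g (poisson_bracket P h f) x
           + poisson_bracket P h (poisson_bracket P f g) x = 0))"


subsection \<open>Lie derivative and exact Poisson manifolds\<close>

definition local_flow ::
  "('v::real_normed_vector \<Rightarrow> 'v) \<Rightarrow> real \<Rightarrow> 'v set \<Rightarrow> (real \<Rightarrow> 'v \<Rightarrow> 'v) \<Rightarrow> bool" where
  "local_flow D \<epsilon> U \<phi> \<longleftrightarrow>
     0 < \<epsilon> \<and> open U \<and>
     smooth_on ({-\<epsilon><..<\<epsilon>} \<times> U) (\<lambda>(t, x). \<phi> t x) \<and>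
     (\<forall>x\<in>U. \<phi> 0 x = x \<and>
        (\<forall>t\<in>{-\<epsilon><..<\<epsilon>}. ((\<lambda>t. \<phi> t x) has_vector_derivative D (\<phi> t x)) (at t)))"

text \<open>
  \<open>has_lie_derivative D P x \<alpha> \<beta> L\<close> says \<open>(\<L>\<^sub>D P)\<^sub>x(\<alpha>, \<beta>) = L\<close>, where \<open>\<L>\<^sub>D P\<close> at \<open>x\<close> is
  the derivative at \<open>t = 0\<close> of the pullback of \<open>P\<close> along the local flow \<open>\<phi>\<close> of \<open>D\<close>, i.e. of
  \<open>(\<phi>\<^bsub>-t\<^esub>)\<^sub>* P\<close>. For smooth \<open>D\<close> local flows exist near every point and any two agree
  near \<open>(0, x)\<close>, so the choice of \<open>\<phi>\<close> is immaterial.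
\<close>

definition has_lie_derivative ::
  "('v::real_normed_vector \<Rightarrow> 'v) \<Rightarrow> 'v bivector_field \<Rightarrow> 'v \<Rightarrow> 'v dual \<Rightarrow> 'v dual \<Rightarrow> real \<Rightarrow> bool" where
  "has_lie_derivative D P x \<alpha> \<beta> L \<longleftrightarrow>
     (\<exists>\<epsilon> U \<phi>. local_flow D \<epsilon> U \<phi> \<and> x \<in> U \<and>
        ((\<lambda>t. transport (\<phi> (-t)) (\<phi> t x) P \<alpha> \<beta>) has_real_derivative L) (at 0))"

definition exact_poisson_manifold ::
  "'v::real_normed_vector bivector_field \<Rightarrow> ('v \<Rightarrow> 'v) \<Rightarrow> bool" where
  "exact_poisson_manifold P D \<longleftrightarrow>
     poisson_manifold P \<and> smooth_on UNIV D \<and>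
     (\<forall>x \<alpha> \<beta>. has_lie_derivative D P x \<alpha> \<beta> (- P x \<alpha> \<beta>))"


subsection \<open>Actions of the multiplicative group of positive reals\<close>

text \<open>Only the values \<open>\<Phi> s\<close> with \<open>s > 0\<close> matter.\<close>

definition smooth_Rpos_action :: "(real \<Rightarrow> 'v::real_normed_vector \<Rightarrow> 'v) \<Rightarrow> bool" where
  "smooth_Rpos_action \<Phi> \<longleftrightarrow>
     (\<forall>x. \<Phi> 1 x = x) \<and>
     (\<forall>s>0. \<forall>t>0. \<forall>x. \<Phi> (s * t) x = \<Phi> s (\<Phi> t x)) \<and>
     smooth_on ({0<..} \<times> UNIV) (\<lambda>(s, x). \<Phi> s x)"

definition infinitesimal_generator ::
  "(real \<Rightarrow> 'v::real_normed_vector \<Rightarrow> 'v) \<Rightarrow> 'v \<Rightarrow> 'v" where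
  "infinitesimal_generator \<Phi> x = vector_derivative (\<lambda>t. \<Phi> (exp t) x) (at 0)"

definition conformally_poisson ::
  "(real \<Rightarrow> 'v::real_normed_vector \<Rightarrow> 'v) \<Rightarrow> 'v bivector_field \<Rightarrow> real \<Rightarrow> bool" where
  "conformally_poisson \<Phi> P c \<longleftrightarrow>
     smooth_Rpos_action \<Phi> \<and>
     (\<forall>s>0. pushforward (\<Phi> s) P = (\<lambda>x \<alpha> \<beta>. s powr c * P x \<alpha> \<beta>))"

definition scaling_action :: "real \<Rightarrow> 'v::real_vector \<Rightarrow> 'v" where
  "scaling_action s \<mu> = s *\<^sub>R \<mu>"


subsection \<open>Lie algebras and the Lie--Poisson tensor\<close>

definition lie_algebra :: "('g::real_vector \<Rightarrow> 'g \<Rightarrow> 'g) \<Rightarrow> bool" where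
  "lie_algebra bracket \<longleftrightarrow>
     bilinear bracket \<and> (\<forall>x. bracket x x = 0) \<and>
     (\<forall>x y z. bracket x (bracket y z) + bracket y (bracket z x) + bracket z (bracket x y) = 0)"

text \<open>
  The canonical map from \<open>\<gg>\<close> to its bidual, which for finite-dimensional \<open>\<gg>\<close> is the isomorphism
  identifying \<open>\<gg>\<close> with the cotangent space of \<open>\<gg>\<^sup>*\<close> at any point.
\<close>

definition bidual_embedding :: "'g::real_normed_vector \<Rightarrow> 'g dual dual" where
  "bidual_embedding X = Blinfun (\<lambda>\<mu>. blinfun_apply \<mu> X)"

definition lie_poisson ::
  "('g::real_normed_vector \<Rightarrow> 'g \<Rightarrow> 'g) \<Rightarrow> 'g dual bivector_field" where
  "lie_poisson bracket \<mu> \<alpha> \<beta> =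
     blinfun_apply \<mu> (bracket (inv bidual_embedding \<alpha>) (inv bidual_embedding \<beta>))"

end

(* The linear function mu |-> mu(X) has constant differential X, so the Lie-Poisson bracket of two
   functions is mu([df, dg]), where df and dg are regarded as Lie-algebra-valued maps. Expanding a
   nested bracket with the product rule, the first-order terms cancel cyclically by the Jacobi
   identity of the Lie algebra and the second-order terms by symmetry of the Hessians. Homogeneity:
   the tensor is linear in mu and bilinear in the covectors, so pushing forward by Phi_s gives the
   factor s^2 from the covectors and 1/s from the base point; along the flow e^t mu of D the
   pulled-back tensor is e^(-t) times the original one, whence the Lie derivative is minus it. *)

theory Submission
  imports Defs
begin

section \<open>Finite-dimensional normed spaces\<close>

text \<open>The constant is the distance from \<open>x\<close> to the closed subspace, positive
  because \<open>x\<close> lies outside it. For nonzero \<open>k\<close>, divide by \<open>k\<close>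
  and compare with the point \<open>- (1 / k) *\<^sub>R s\<close> of \<open>span B\<close>. Thus the
  coefficient of \<open>x\<close> is controlled by the norm, which drives the two inductions over
  finite spanning sets below.\<close>

lemma coefficient_bound:
  fixes x :: "'a::real_normed_vector"
  assumes "closed (span B)" and "x \<notin> span B"
  shows "\<exists>d>0. \<forall>k. \<forall>s\<in>span B. d * \<bar>k\<bar> \<le> norm (k *\<^sub>R x + s)"
proof (intro exI[of _ "infdist x (span B)"] conjI allI ballI)
  have ne: "span B \<noteq> {}" using span_zero by blast
  show "infdist x (span B) > 0"
    using in_closed_iff_infdist_zero[OF assms(1) ne] assms(2) infdist_nonneg[of x "span B"]
    by (metis less_eq_real_def)
  fix k s assume s: "s \<in> span B"
  show "infdist x (span B) * \<bar>k\<bar> \<le> norm (k *\<^sub>R x + s)"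
  proof (cases "k = 0")
    case False
    have "- (1 / k) *\<^sub>R s \<in> span B" using s by (rule span_scale)
    then have "infdist x (span B) \<le> dist x (- (1 / k) *\<^sub>R s)" by (rule infdist_le)
    then have "infdist x (span B) * \<bar>k\<bar> \<le> norm (x + (1 / k) *\<^sub>R s) * \<bar>k\<bar>"
      by (intro mult_right_mono) (simp_all add: dist_norm)
    also have "\<dots> = norm (k *\<^sub>R (x + (1 / k) *\<^sub>R s))" by simp
    also have "k *\<^sub>R (x + (1 / k) *\<^sub>R s) = k *\<^sub>R x + s" using False by (simp add: scaleR_add_right)
    finally show ?thesis .
  qed simp
qed

text \<open>Induction on \<open>B\<close>: a Cauchy sequence splits into multiples of the new vector
  \<open>x\<close> and remainders in \<open>span B\<close>. The coefficient bound makes the real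
  coefficients Cauchy, hence also the remainders, and these converge by the induction hypothesis.
  That hypothesis also supplies the closedness required by the bound.\<close>

lemma complete_span_finite:
  fixes B :: "'a::real_normed_vector set"
  assumes "finite B"
  shows "complete (span B)"
  using assms
proof (induction B)
  case empty
  then show ?case by (simp add: compact_imp_complete)
next
  case (insert x B)
  show ?case
  proof (cases "x \<in> span B")
    case True
    then show ?thesis using insert.IH by (simp add: span_redundant)
  next
    case False
    obtain d where d: "d > 0" "\<And>k s. s \<in> span B \<Longrightarrow> d * \<bar>k\<bar> \<le> norm (k *\<^sub>R x + s)"
      using coefficient_bound[OF complete_imp_closed[OF insert.IH] False] by blast
    show ?thesis
    proof (rule completeI)
      fix f :: "nat \<Rightarrow> 'a"
      assume f: "\<forall>n. f n \<in> span (insert x B)" and C: "Cauchy f"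
      have "\<forall>n. \<exists>k. f n - k *\<^sub>R x \<in> span B" using f span_breakdown_eq by blast
      then obtain k where k: "\<And>n. f n - k n *\<^sub>R x \<in> span B" by metis
      have diff: "d * \<bar>k m - k n\<bar> \<le> norm (f m - f n)" for m n
        using d(2)[OF span_diff[OF k[of m] k[of n]], of "k m - k n"] by (simp add: algebra_simps)
      have "Cauchy k"
      proof (rule metric_CauchyI)
        fix e :: real assume "e > 0"
        then obtain M where M: "\<And>m n. m \<ge> M \<Longrightarrow> n \<ge> M \<Longrightarrow> dist (f m) (f n) < d * e"
          using metric_CauchyD[OF C, of "d * e"] d(1) by auto
        have "dist (k m) (k n) < e" if "m \<ge> M" "n \<ge> M" for m n
        proof -
          have "d * \<bar>k m - k n\<bar> < d * e"
            using diff[of m n] M[OF that] by (simp add: dist_norm)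
          then show ?thesis using d(1) by (simp add: dist_real_def)
        qed
        then show "\<exists>M. \<forall>m\<ge>M. \<forall>n\<ge>M. dist (k m) (k n) < e" by blast
      qed
      then obtain l where l: "k \<longlonglongrightarrow> l" using Cauchy_convergent_iff convergent_def by blast
      have kx: "(\<lambda>n. k n *\<^sub>R x) \<longlonglongrightarrow> l *\<^sub>R x" using l by (intro tendsto_intros)
      have "Cauchy (\<lambda>n. f n - k n *\<^sub>R x)"
      proof (rule metric_CauchyI)
        fix e :: real assume "e > 0"
        obtain M where
          M: "\<And>m n. m \<ge> M \<Longrightarrow> n \<ge> M \<Longrightarrow> dist (f m) (f n) < e / 2"
          using metric_CauchyD[OF C, of "e / 2"] \<open>e > 0\<close> by auto
        obtain N where
          N: "\<And>m n. m \<ge> N \<Longrightarrow> n \<ge> N \<Longrightarrow> dist (k m *\<^sub>R x) (k n *\<^sub>R x) < e / 2"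
          using metric_CauchyD[OF LIMSEQ_imp_Cauchy[OF kx], of "e / 2"] \<open>e > 0\<close> half_gt_zero by blast
        have "dist (f m - k m *\<^sub>R x) (f n - k n *\<^sub>R x) < e" if "m \<ge> max M N" "n \<ge> max M N" for m n
        proof -
          have "dist (f m - k m *\<^sub>R x) (f n - k n *\<^sub>R x)
              \<le> dist (f m) (f n) + dist (k m *\<^sub>R x) (k n *\<^sub>R x)"
            unfolding dist_norm using norm_triangle_ineq4[of "f m - f n" "k m *\<^sub>R x - k n *\<^sub>R x"]
            by (simp add: algebra_simps)
          then show ?thesis using M[of m n] N[of m n] that by simp
        qed
        then show "\<exists>M. \<forall>m\<ge>M. \<forall>n\<ge>M. dist (f m - k m *\<^sub>R x) (f n - k n *\<^sub>R x) < e" by blast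
      qed
      then obtain s where s: "s \<in> span B" "(\<lambda>n. f n - k n *\<^sub>R x) \<longlonglongrightarrow> s"
        by (rule completeE[OF insert.IH allI[OF k]])
      have "f \<longlonglongrightarrow> s + l *\<^sub>R x" using tendsto_add[OF s(2) kx] by simp
      moreover have "s + l *\<^sub>R x \<in> span (insert x B)"
        using s(1) unfolding span_breakdown_eq by (intro exI[of _ l]) simp
      ultimately show "\<exists>l\<in>span (insert x B). f \<longlonglongrightarrow> l" by blast
    qed
  qed
qed

lemma linear_bounded_on_span_finite:
  fixes f :: "'a::real_normed_vector \<Rightarrow> 'b::real_normed_vector"
  assumes "finite B" and f: "linear f"
  shows "\<exists>K\<ge>0. \<forall>x\<in>span B. norm (f x) \<le> K * norm x"
  using assms(1)
proof (induction B)
  case empty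
  then show ?case using linear_0[OF f] by auto
next
  case (insert x B)
  then obtain K where K: "K \<ge> 0" "\<And>y. y \<in> span B \<Longrightarrow> norm (f y) \<le> K * norm y" by blast
  show ?case
  proof (cases "x \<in> span B")
    case True
    then show ?thesis using K by (auto simp: span_redundant)
  next
    case False
    obtain d where d: "d > 0" "\<And>k s. s \<in> span B \<Longrightarrow> d * \<bar>k\<bar> \<le> norm (k *\<^sub>R x + s)"
      using coefficient_bound[OF complete_imp_closed[OF complete_span_finite[OF insert.hyps(1)]] False]
      by blast
    \<comment> \<open>The coefficient \<open>k\<close> of \<open>x\<close> in \<open>y\<close>
      satisfies \<open>\<bar>k\<bar> \<le> norm y / d\<close>, and the remainder has norm at most
      \<open>norm y + \<bar>k\<bar> * norm x\<close>; collecting the factors of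
      \<open>norm y\<close> gives this constant.\<close>
    let ?C = "(norm (f x) + K * norm x) / d + K"
    have "norm (f y) \<le> ?C * norm y" if y: "y \<in> span (insert x B)" for y
    proof -
      obtain k where k: "y - k *\<^sub>R x \<in> span B" using y span_breakdown_eq[of y x B] by blast
      have kd: "\<bar>k\<bar> \<le> norm y / d" using d(2)[OF k, of k] d(1) by (simp add: field_simps)
      have "f y = k *\<^sub>R f x + f (y - k *\<^sub>R x)"
        by (simp add: linear_diff[OF f] linear_scale[OF f])
      then have "norm (f y) \<le> \<bar>k\<bar> * norm (f x) + norm (f (y - k *\<^sub>R x))"
        using norm_triangle_ineq[of "k *\<^sub>R f x" "f (y - k *\<^sub>R x)"] by simp
      also have "\<dots> \<le> \<bar>k\<bar> * norm (f x) + K * (norm y + \<bar>k\<bar> * norm x)"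
        using K(2)[OF k] mult_left_mono[OF norm_triangle_ineq4[of y "k *\<^sub>R x"] K(1)] by simp
      also have "\<dots> = \<bar>k\<bar> * (norm (f x) + K * norm x) + K * norm y" by (simp add: algebra_simps)
      also have "\<dots> \<le> norm y / d * (norm (f x) + K * norm x) + K * norm y"
        using kd K(1) by (intro add_right_mono mult_right_mono) auto
      also have "\<dots> = ?C * norm y" by (simp add: algebra_simps add_divide_distrib)
      finally show ?thesis .
    qed
    moreover have "?C \<ge> 0" using K(1) d(1) by simp
    ultimately show ?thesis by blast
  qed
qed

lemma bounded_linear_finite_dimensional:
  fixes f :: "'a::real_normed_vector \<Rightarrow> 'b::real_normed_vector"
  assumes "finite_dimensional TYPE('a)" and "linear f"
  shows "bounded_linear f"
proof -
  obtain B :: "'a set" where B: "finite B" "span B = UNIV"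
    using assms(1) unfolding finite_dimensional_def by blast
  obtain K where "\<And>x. norm (f x) \<le> norm x * K"
    using linear_bounded_on_span_finite[OF B(1) assms(2)] B(2) by (auto simp: mult.commute)
  then show ?thesis using assms(2)
    by (intro bounded_linear.intro bounded_linear_axioms.intro) auto
qed

text \<open>Currying turns \<open>f\<close> into a linear map from the first space into the bounded
  operators on the second. Automatic boundedness is applied once to each \<open>f x\<close> and once
  to the curried map, whose bound is then a bound for \<open>f\<close>.\<close>

lemma bounded_bilinear_finite_dimensional:
  fixes f :: "'a::real_normed_vector \<Rightarrow> 'b::real_normed_vector \<Rightarrow> 'c::real_normed_vector"
  assumes "finite_dimensional TYPE('a)" and "finite_dimensional TYPE('b)" and f: "bilinear f"
  shows "bounded_bilinear f"
proof -
  have ap: "blinfun_apply (Blinfun (f x)) = f x" for x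
    using f assms(2) unfolding bilinear_def
    by (intro bounded_linear_Blinfun_apply bounded_linear_finite_dimensional) auto
  have "linear (\<lambda>x. Blinfun (f x))"
    by (intro linearI blinfun_eqI)
      (simp_all add: ap blinfun.bilinear_simps bilinear_ladd[OF f] bilinear_lmul[OF f])
  then obtain K where K: "\<And>x. norm (Blinfun (f x)) \<le> norm x * K"
    using bounded_linear.bounded[OF bounded_linear_finite_dimensional[OF assms(1)]] by blast
  have "norm (f x y) \<le> norm x * norm y * K" for x y
  proof -
    have "norm (f x y) \<le> norm (Blinfun (f x)) * norm y"
      using norm_blinfun[of "Blinfun (f x)" y] by (simp add: ap)
    also have "\<dots> \<le> norm x * K * norm y" using K by (intro mult_right_mono) auto
    finally show ?thesis by (simp add: algebra_simps)
  qed
  then show ?thesis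
    by (intro bounded_bilinear.intro exI[of _ K] allI)
      (simp_all add: bilinear_ladd[OF f] bilinear_radd[OF f] bilinear_lmul[OF f] bilinear_rmul[OF f])
qed

section \<open>Coordinate functionals, the dual space and the bidual\<close>

lemma finite_dimensional_coordinates:
  assumes "finite_dimensional TYPE('a::real_normed_vector)"
  obtains B and e :: "'a::real_normed_vector \<Rightarrow> 'a dual"
  where "finite B" and "\<And>x. (\<Sum>b\<in>B. e b x *\<^sub>R b) = x"
proof -
  obtain C :: "'a set" where C: "finite C" "span C = UNIV"
    using assms unfolding finite_dimensional_def by blast
  obtain B where B: "B \<subseteq> C" "independent B" "C \<subseteq> span B"
    by (rule maximal_independent_subset)
  have fin: "finite B" using B(1) C(1) by (rule finite_subset)
  have sp: "span B = UNIV" using span_mono[OF B(3)] C(2) by (auto simp: span_span)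
  \<comment> \<open>These are the coordinate functionals of the basis \<open>B\<close>; finite
    dimension makes them bounded, so that \<open>Blinfun\<close> does not alter them.\<close>
  define e where "e b = Blinfun (\<lambda>x. representation B x b)" for b
  have "blinfun_apply (e b) = (\<lambda>x. representation B x b)" for b
    unfolding e_def using B(2) sp
    by (intro bounded_linear_Blinfun_apply bounded_linear_finite_dimensional[OF assms] linearI)
      (simp_all add: real_vector.representation_add real_vector.representation_scale)
  moreover have "(\<Sum>b\<in>B. representation B x b *\<^sub>R b) = x" for x
    using real_vector.sum_representation_eq[OF B(2) _ fin order_refl, of x] sp by simp
  ultimately show ?thesis using that[OF fin, of e] by simp
qed

text \<open>Applying \<mu> to the expansion of a vector shows that the coefficients of \<mu> along
  the coordinate functionals are its values on the vectors of \<open>B\<close>.\<close>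

lemma dual_coordinates:
  fixes e :: "'a::real_normed_vector \<Rightarrow> 'a dual" and \<mu> :: "'a dual"
  assumes "\<And>x. (\<Sum>b\<in>B. e b x *\<^sub>R b) = x"
  shows "(\<Sum>b\<in>B. \<mu> b *\<^sub>R e b) = \<mu>"
proof (rule blinfun_eqI)
  fix x
  have "\<mu> x = \<mu> (\<Sum>b\<in>B. e b x *\<^sub>R b)" using assms by simp
  also have "\<dots> = (\<Sum>b\<in>B. \<mu> b *\<^sub>R e b) x"
    by (simp add: blinfun.bilinear_simps blinfun.sum_left blinfun.sum_right mult.commute)
  finally show "(\<Sum>b\<in>B. \<mu> b *\<^sub>R e b) x = \<mu> x" ..
qed

lemma finite_dimensional_dual:
  assumes "finite_dimensional TYPE('a::real_normed_vector)"
  shows "finite_dimensional TYPE('a dual)"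
proof -
  obtain B and e :: "'a \<Rightarrow> 'a dual"
    where B: "finite B" "\<And>x. (\<Sum>b\<in>B. e b x *\<^sub>R b) = x"
    using finite_dimensional_coordinates[OF assms] by metis
  have "\<mu> \<in> span (e ` B)" for \<mu>
    by (subst dual_coordinates[OF B(2), symmetric]) (intro span_sum span_scale span_base imageI)
  then show ?thesis unfolding finite_dimensional_def using B(1) by (intro exI[of _ "e ` B"]) auto
qed

lemma bidual_embedding_apply: "blinfun_apply (bidual_embedding X) \<mu> = blinfun_apply \<mu> X"
  unfolding bidual_embedding_def
  by (simp add: bounded_linear_Blinfun_apply blinfun.bounded_linear_left)

text \<open>Injective because the coordinate functionals separate vectors. Surjective because
  \<open>\<Sum>b\<in>B. \<alpha> (e b) *\<^sub>R b\<close> is an explicit preimage of \<alpha>, by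
  the expansion of functionals in the dual coordinates.\<close>

lemma bij_bidual_embedding:
  assumes "finite_dimensional TYPE('a::real_normed_vector)"
  shows "bij (bidual_embedding :: 'a \<Rightarrow> 'a dual dual)"
proof -
  obtain B and e :: "'a \<Rightarrow> 'a dual"
    where B: "finite B" "\<And>x. (\<Sum>b\<in>B. e b x *\<^sub>R b) = x"
    using finite_dimensional_coordinates[OF assms] by metis
  have "inj (bidual_embedding :: 'a \<Rightarrow> 'a dual dual)"
  proof (rule injI)
    fix X Y :: 'a assume "bidual_embedding X = bidual_embedding Y"
    then have "\<mu> X = \<mu> Y" for \<mu> :: "'a dual" by (metis bidual_embedding_apply)
    then have "(\<Sum>b\<in>B. e b X *\<^sub>R b) = (\<Sum>b\<in>B. e b Y *\<^sub>R b)" by (simp only:)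
    then show "X = Y" by (simp only: B(2))
  qed
  moreover have "bidual_embedding (\<Sum>b\<in>B. \<alpha> (e b) *\<^sub>R b) = \<alpha>" for \<alpha> :: "'a dual dual"
  proof (rule blinfun_eqI)
    fix \<mu> :: "'a dual"
    have "\<alpha> \<mu> = \<alpha> (\<Sum>b\<in>B. \<mu> b *\<^sub>R e b)" using dual_coordinates[OF B(2)] by simp
    then show "bidual_embedding (\<Sum>b\<in>B. \<alpha> (e b) *\<^sub>R b) \<mu> = \<alpha> \<mu>"
      by (simp add: bidual_embedding_apply blinfun.bilinear_simps blinfun.sum_left
          blinfun.sum_right mult.commute)
  qed
  then have "surj (bidual_embedding :: 'a \<Rightarrow> 'a dual dual)" by (rule surjI)
  ultimately show ?thesis by (simp add: bij_def)
qed

lemma blinfun_apply_inv_bidual_embedding: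
  fixes \<alpha> :: "'a::real_normed_vector dual dual"
  assumes "finite_dimensional TYPE('a)"
  shows "blinfun_apply \<mu> (inv bidual_embedding \<alpha>) = blinfun_apply \<alpha> \<mu>"
  using bidual_embedding_apply[of "inv bidual_embedding \<alpha>" \<mu>]
  unfolding surj_f_inv_f[OF bij_is_surj[OF bij_bidual_embedding[OF assms]]] by (rule sym)

lemma linear_inv_bidual_embedding:
  assumes "finite_dimensional TYPE('a::real_normed_vector)"
  shows "linear (inv bidual_embedding :: 'a dual dual \<Rightarrow> 'a)"
proof -
  \<comment> \<open>A vector is the preimage of \<alpha> as soon as every functional takes the right
    value on it; with this criterion, additivity and homogeneity become pointwise checks.\<close>
  have *: "inv bidual_embedding \<alpha> = X" if "\<And>\<mu>. blinfun_apply \<mu> X = blinfun_apply \<alpha> \<mu>"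
    for \<alpha> and X :: 'a
  proof -
    have "bidual_embedding X = \<alpha>" using that by (intro blinfun_eqI) (simp add: bidual_embedding_apply)
    then show ?thesis using bij_bidual_embedding[OF assms] by (metis bij_is_inj inv_f_f)
  qed
  show ?thesis
    by (intro linearI *)
      (simp_all add: blinfun.bilinear_simps blinfun_apply_inv_bidual_embedding[OF assms])
qed


section \<open>Smooth maps and symmetry of second derivatives\<close>

lemma smooth_on_imp_differentiable: "smooth_on S f \<Longrightarrow> x \<in> S \<Longrightarrow> f differentiable at x"
  unfolding smooth_on_def by (drule spec[of _ "Suc 0"]) simp

lemma smooth_on_frechet_derivative:
  assumes "smooth_on S f"
  shows "smooth_on S (\<lambda>x. frechet_derivative f (at x) v)"
  unfolding smooth_on_def
proof
  fix n
  have "C_n_on (Suc n) S f" using assms unfolding smooth_on_def by (rule spec)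
  then show "C_n_on n S (\<lambda>x. frechet_derivative f (at x) v)" by simp
qed

lemma smooth_on_imp_continuous_on: "smooth_on S f \<Longrightarrow> continuous_on S f"
  unfolding smooth_on_def by (drule spec[of _ 0]) simp

lemma smooth_on_imp_has_derivative:
  "smooth_on S f \<Longrightarrow> x \<in> S \<Longrightarrow> (f has_derivative frechet_derivative f (at x)) (at x)"
  by (rule frechet_derivative_works[THEN iffD1, OF smooth_on_imp_differentiable])

text \<open>Closure under directional derivatives lets one induction on the order treat all members
  at once, with order 0 following from differentiability. The smoothness proofs below then only need
  a suitable family, not a formula for higher derivatives.\<close>

lemma smooth_on_family:
  assumes "f \<in> F"
    and "\<And>g x. g \<in> F \<Longrightarrow> x \<in> S \<Longrightarrow> g differentiable at x"
    and "\<And>g v. g \<in> F \<Longrightarrow> (\<lambda>x. frechet_derivative g (at x) v) \<in> F"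
  shows "smooth_on S f"
proof -
  have "\<forall>g\<in>F. C_n_on n S g" for n
  proof (induction n)
    case 0
    then show ?case
      using assms(2) by (auto intro!: differentiable_imp_continuous_on differentiable_at_imp_differentiable_on)
  next
    case (Suc n)
    then show ?case using assms(2,3) by simp
  qed
  then show ?thesis using assms(1) by (simp add: smooth_on_def)
qed

lemma smooth_on_bounded_linear:
  assumes "bounded_linear f"
  shows "smooth_on S f"
\<comment> \<open>A bounded linear map is its own derivative at every point, so its directional
  derivatives are constant; adjoining the constants closes the family.\<close>
proof (rule smooth_on_family[where F = "insert f (range (\<lambda>c x. c))"])
  have d: "(f has_derivative f) (at x)" for x
    using assms by (rule bounded_linear_imp_has_derivative)
  show "g differentiable at x" if "g \<in> insert f (range (\<lambda>c x. c))" for g x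
    using that by (auto intro: differentiableI[OF d])
  have fd: "frechet_derivative f (at x) = f" for x
    by (rule frechet_derivative_at[OF d, symmetric])
  show "(\<lambda>x. frechet_derivative g (at x) v) \<in> insert f (range (\<lambda>c x. c))"
    if "g \<in> insert f (range (\<lambda>c x. c))" for g v
    using that by (auto simp: fd)
qed auto

lemma smooth_on_scaleR: "smooth_on S (\<lambda>(s, x). s *\<^sub>R x :: 'a::real_normed_vector)"
\<comment> \<open>The directional derivatives of a bilinear map are linear, and those of a linear
  map are constant.\<close>
proof (rule smooth_on_family[where F = "insert (\<lambda>(s, x). s *\<^sub>R x) (Collect bounded_linear \<union> range (\<lambda>c x. c))"])
  let ?m = "\<lambda>(s, x). s *\<^sub>R x :: 'a"
  let ?F = "insert ?m (Collect bounded_linear \<union> range (\<lambda>c x. c))"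
  have d: "(?m has_derivative (\<lambda>v. fst p *\<^sub>R snd v + fst v *\<^sub>R snd p)) (at p)" for p
    unfolding case_prod_unfold by (auto intro!: derivative_eq_intros)
  have fd: "frechet_derivative ?m (at p) = (\<lambda>v. fst p *\<^sub>R snd v + fst v *\<^sub>R snd p)" for p
    by (rule frechet_derivative_at[OF d, symmetric])
  have bl: "bounded_linear (\<lambda>p. fst p *\<^sub>R snd v + fst v *\<^sub>R snd p)" for v :: "real \<times> 'a"
    by (intro bounded_linear_add bounded_linear_scaleR_const bounded_linear_const_scaleR
        bounded_linear_fst bounded_linear_snd)
  have lin: "frechet_derivative g (at x) = g" if "bounded_linear g" for g :: "real \<times> 'a \<Rightarrow> 'a" and x
    by (rule frechet_derivative_at[OF bounded_linear_imp_has_derivative[OF that], symmetric])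
  show "g differentiable at x" if "g \<in> ?F" for g x
    using that by (auto intro: differentiableI[OF d] differentiableI[OF bounded_linear_imp_has_derivative])
  show "(\<lambda>x. frechet_derivative g (at x) v) \<in> ?F" if "g \<in> ?F" for g v
    using that by (auto simp: fd lin bl)
qed auto

lemma smooth_on_exp_scaleR: "smooth_on S (\<lambda>(t, x). exp t *\<^sub>R x :: 'a::real_normed_vector)"
\<comment> \<open>Differentiating in the direction \<open>v\<close> replaces \<open>a\<close> by
  \<open>fst v * a\<close> and \<open>c\<close> by
  \<open>fst v *\<^sub>R c + a *\<^sub>R snd v\<close>, so this affine family is closed.\<close>
proof (rule smooth_on_family[where F = "{\<lambda>p. exp (fst p) *\<^sub>R (a *\<^sub>R snd p + c) | a c. True}"])
  let ?f = "\<lambda>a (c::'a) p. exp (fst p) *\<^sub>R (a *\<^sub>R snd p + c)"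
  let ?F = "{\<lambda>p. exp (fst p) *\<^sub>R (a *\<^sub>R snd p + (c::'a)) | a c. True}"
  have "(\<lambda>(t, x). exp t *\<^sub>R x) = ?f 1 0" by auto
  then show "(\<lambda>(t, x). exp t *\<^sub>R x) \<in> ?F" by blast
  have d: "(?f a c has_derivative
      (\<lambda>v. ?f (fst v * a) (fst v *\<^sub>R c + a *\<^sub>R snd v) p)) (at p)" for a c p
    by (auto intro!: derivative_eq_intros simp: algebra_simps)
  show "g differentiable at x" if "g \<in> ?F" for g x
    using that d unfolding differentiable_def by blast
  have "(\<lambda>x. frechet_derivative (?f a c) (at x) v) = ?f (fst v * a) (fst v *\<^sub>R c + a *\<^sub>R snd v)" for a c v
    by (rule ext, subst frechet_derivative_at[OF d, symmetric]) simp
  then show "(\<lambda>x. frechet_derivative g (at x) v) \<in> ?F" if "g \<in> ?F" for g v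
    using that by blast
qed

section \<open>Symmetry of second derivatives\<close>

lemma has_real_derivative_along_line:
  fixes f :: "'a::real_normed_vector \<Rightarrow> real"
  assumes "smooth_on UNIV f"
  shows "((\<lambda>s. f (x + s *\<^sub>R u)) has_real_derivative
    frechet_derivative f (at (x + s *\<^sub>R u)) u) (at s)"
proof -
  have D: "(f has_derivative frechet_derivative f (at (x + s *\<^sub>R u))) (at (x + s *\<^sub>R u))"
    using smooth_on_imp_has_derivative[OF assms] by simp
  have "((\<lambda>s. x + s *\<^sub>R u) has_derivative (\<lambda>h. h *\<^sub>R u)) (at s)"
    by (auto intro!: derivative_eq_intros)
  from has_derivative_compose[OF this D]
  show ?thesis unfolding has_field_derivative_def
    using linear_scale[OF has_derivative_linear[OF D]] by (simp add: mult_commute_abs)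
qed

text \<open>Two uses of the mean value theorem: first along \<open>u\<close>, for the difference of
  \<open>f\<close> on two parallel lines offset by \<open>t *\<^sub>R v\<close>; then along
  \<open>v\<close>, for the directional derivative that the first use produces.\<close>

lemma second_difference_mvt:
  fixes f :: "'a::real_normed_vector \<Rightarrow> real"
  assumes f: "smooth_on UNIV f" and t: "t > 0"
  shows "\<exists>s r. 0 < s \<and> s < t \<and> 0 < r \<and> r < t \<and>
    f (x + t *\<^sub>R u + t *\<^sub>R v) - f (x + t *\<^sub>R u) - f (x + t *\<^sub>R v) + f x
    = t * t * frechet_derivative (\<lambda>y. frechet_derivative f (at y) u) (at (x + s *\<^sub>R u + r *\<^sub>R v)) v"
proof -
  let ?g = "\<lambda>s. f ((x + t *\<^sub>R v) + s *\<^sub>R u) - f (x + s *\<^sub>R u)"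
  let ?D = "\<lambda>y. frechet_derivative f (at y) u"
  have D1: "(?g has_real_derivative ?D ((x + t *\<^sub>R v) + s *\<^sub>R u) - ?D (x + s *\<^sub>R u)) (at s)" for s
    by (intro DERIV_diff has_real_derivative_along_line f)
  obtain s where s: "0 < s" "s < t"
    "?g t - ?g 0 = (t - 0) * (?D ((x + t *\<^sub>R v) + s *\<^sub>R u) - ?D (x + s *\<^sub>R u))"
    using MVT2[OF t D1] by blast
  have D2: "((\<lambda>r. ?D ((x + s *\<^sub>R u) + r *\<^sub>R v)) has_real_derivative
      frechet_derivative ?D (at ((x + s *\<^sub>R u) + r *\<^sub>R v)) v) (at r)" for r
    by (rule has_real_derivative_along_line[OF smooth_on_frechet_derivative[OF f]])
  obtain r where r: "0 < r" "r < t"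
    "?D ((x + s *\<^sub>R u) + t *\<^sub>R v) - ?D ((x + s *\<^sub>R u) + 0 *\<^sub>R v)
      = (t - 0) * frechet_derivative ?D (at ((x + s *\<^sub>R u) + r *\<^sub>R v)) v"
    using MVT2[OF t D2] by blast
  have comm: "x + s *\<^sub>R u + t *\<^sub>R v = x + t *\<^sub>R v + s *\<^sub>R u" "x + t *\<^sub>R u + t *\<^sub>R v = x + t *\<^sub>R v + t *\<^sub>R u"
    by (simp_all add: algebra_simps)
  have "f (x + t *\<^sub>R u + t *\<^sub>R v) - f (x + t *\<^sub>R u) - f (x + t *\<^sub>R v) + f x = ?g t - ?g 0"
    unfolding comm by simp
  also have "\<dots> = t * (?D (x + s *\<^sub>R u + t *\<^sub>R v) - ?D (x + s *\<^sub>R u))"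
    unfolding s(3) comm by simp
  also have "\<dots> = t * t * frechet_derivative ?D (at (x + s *\<^sub>R u + r *\<^sub>R v)) v"
    using r(3) by simp
  finally show ?thesis using s(1,2) r(1,2) by blast
qed

text \<open>The second difference is symmetric in \<open>u\<close> and \<open>v\<close>. Hence the
  two mixed derivatives share a value at points arbitrarily close to \<open>x\<close>, and their
  continuity rules out a gap at \<open>x\<close>; the tolerance \<open>?e\<close> is half the
  supposed gap.\<close>

lemma symmetric_second_derivative:
  fixes f :: "'a::real_normed_vector \<Rightarrow> real"
  assumes f: "smooth_on UNIV f"
  shows "frechet_derivative (\<lambda>y. frechet_derivative f (at y) u) (at x) v
    = frechet_derivative (\<lambda>y. frechet_derivative f (at y) v) (at x) u"
proof (rule ccontr)
  define H where "H u v y = frechet_derivative (\<lambda>y. frechet_derivative f (at y) u) (at y) v" for u v y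
  assume "\<not> ?thesis"
  then have e: "\<bar>H u v x - H v u x\<bar> / 2 > 0" (is "?e > 0") by (simp add: H_def)
  have cont: "isCont (H u v) x" for u v
  proof -
    have "continuous_on UNIV (H u v)"
      using smooth_on_imp_continuous_on[OF smooth_on_frechet_derivative[OF smooth_on_frechet_derivative[OF f]]]
      unfolding H_def .
    then show ?thesis by (simp add: continuous_on_eq_continuous_at)
  qed
  obtain d1 where d1: "d1 > 0" "\<And>y. dist y x < d1 \<Longrightarrow> dist (H u v y) (H u v x) < ?e"
    using cont[of u v] e unfolding continuous_at_eps_delta by blast
  obtain d2 where d2: "d2 > 0" "\<And>y. dist y x < d2 \<Longrightarrow> dist (H v u y) (H v u x) < ?e"
    using cont[of v u] e unfolding continuous_at_eps_delta by blast
  \<comment> \<open>Chosen so that all intermediate points from the mean value theorem lie within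
    \<open>min d1 d2\<close> of \<open>x\<close>; the summand 1 keeps the denominator positive and
    the estimate strict.\<close>
  define t where "t = min d1 d2 / (norm u + norm v + 1)"
  have pos: "norm u + norm v + 1 > 0" by (smt (verit) norm_ge_zero)
  have t: "t > 0" using d1(1) d2(1) pos by (simp add: t_def)
  have near: "dist (x + s *\<^sub>R u + r *\<^sub>R v) x < min d1 d2" if "0 < s" "s < t" "0 < r" "r < t" for s r
  proof -
    have "dist (x + s *\<^sub>R u + r *\<^sub>R v) x = norm (s *\<^sub>R u + r *\<^sub>R v)" by (simp add: dist_norm algebra_simps)
    also have "\<dots> \<le> s * norm u + r * norm v"
      using norm_triangle_ineq[of "s *\<^sub>R u" "r *\<^sub>R v"] that by simp
    also have "\<dots> \<le> t * norm u + t * norm v" using that by (intro add_mono mult_right_mono) auto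
    also have "\<dots> < t * (norm u + norm v + 1)" using t by (simp add: algebra_simps)
    also have "\<dots> = min d1 d2" using pos by (simp add: t_def)
    finally show ?thesis .
  qed
  obtain s r where sr: "0 < s" "s < t" "0 < r" "r < t"
    "f (x + t *\<^sub>R u + t *\<^sub>R v) - f (x + t *\<^sub>R u) - f (x + t *\<^sub>R v) + f x
      = t * t * H u v (x + s *\<^sub>R u + r *\<^sub>R v)"
    using second_difference_mvt[OF f t, of x u v] unfolding H_def by blast
  obtain s' r' where sr': "0 < s'" "s' < t" "0 < r'" "r' < t"
    "f (x + t *\<^sub>R v + t *\<^sub>R u) - f (x + t *\<^sub>R v) - f (x + t *\<^sub>R u) + f x
      = t * t * H v u (x + s' *\<^sub>R v + r' *\<^sub>R u)"
    using second_difference_mvt[OF f t, of x v u] unfolding H_def by blast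
  have c: "x + t *\<^sub>R v + t *\<^sub>R u = x + t *\<^sub>R u + t *\<^sub>R v"
    "x + s' *\<^sub>R v + r' *\<^sub>R u = x + r' *\<^sub>R u + s' *\<^sub>R v" by (simp_all add: algebra_simps)
  have "t * t * H u v (x + s *\<^sub>R u + r *\<^sub>R v) = t * t * H v u (x + r' *\<^sub>R u + s' *\<^sub>R v)"
    using sr(5) sr'(5) unfolding c by linarith
  then have eq: "H u v (x + s *\<^sub>R u + r *\<^sub>R v) = H v u (x + r' *\<^sub>R u + s' *\<^sub>R v)"
    using t by simp
  have "dist (H u v (x + s *\<^sub>R u + r *\<^sub>R v)) (H u v x) < ?e"
    using near[OF sr(1-4)] by (intro d1(2)) simp
  moreover have "dist (H v u (x + r' *\<^sub>R u + s' *\<^sub>R v)) (H v u x) < ?e"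
    using near[OF sr'(3,4,1,2)] by (intro d2(2)) simp
  ultimately show False unfolding eq dist_real_def by (auto simp: abs_if split: if_splits)
qed


section \<open>The Lie--Poisson structure\<close>

lemma differential_apply:
  assumes "smooth_on UNIV f"
  shows "blinfun_apply (differential f x) = frechet_derivative f (at x)"
  unfolding differential_def
  by (rule bounded_linear_Blinfun_apply[OF has_derivative_bounded_linear[OF
      smooth_on_imp_has_derivative[OF assms UNIV_I]]])

text \<open>
  Under \<open>\<gg>\<^sup>*\<^sup>* \<cong> \<gg>\<close> the differential of a function on \<open>\<gg>\<^sup>*\<close> becomes a \<open>\<gg>\<close>-valued map, whose
  derivative is the second derivative of the function.
\<close>

lemma inv_bidual_differential_has_derivative:
  fixes f :: "'g::real_normed_vector dual \<Rightarrow> real"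
  assumes fd: "finite_dimensional TYPE('g)" and f: "smooth_on UNIV f"
  obtains X' where
    "((\<lambda>y. inv bidual_embedding (differential f y)) has_derivative X') (at x)"
    "\<And>\<mu> v. blinfun_apply \<mu> (X' v)
      = frechet_derivative (\<lambda>y. frechet_derivative f (at y) \<mu>) (at x) v"
proof -
  let ?X = "\<lambda>y. inv bidual_embedding (differential f y)"
  let ?H = "\<lambda>\<mu>. frechet_derivative (\<lambda>y. frechet_derivative f (at y) \<mu>) (at x)"
  obtain B and e :: "'g \<Rightarrow> 'g dual"
    where B: "finite B" "\<And>x. (\<Sum>b\<in>B. e b x *\<^sub>R b) = x"
    using finite_dimensional_coordinates[OF fd] by metis
  have ap: "blinfun_apply \<mu> (?X y) = frechet_derivative f (at y) \<mu>" for \<mu> y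
    by (simp add: blinfun_apply_inv_bidual_embedding[OF fd] differential_apply[OF f])
  have H: "((\<lambda>y. frechet_derivative f (at y) \<mu>) has_derivative ?H \<mu>) (at x)" for \<mu>
    by (intro smooth_on_imp_has_derivative[OF smooth_on_frechet_derivative[OF f]] UNIV_I)
  \<comment> \<open>In coordinates the map is a finite sum of scalar directional derivatives times
    fixed vectors, so smoothness of \<open>f\<close> gives its derivative term by term.\<close>
  have "?X = (\<lambda>y. \<Sum>b\<in>B. frechet_derivative f (at y) (e b) *\<^sub>R b)"
    using B(2) by (simp add: ap[symmetric])
  moreover have "((\<lambda>y. \<Sum>b\<in>B. frechet_derivative f (at y) (e b) *\<^sub>R b) has_derivative
      (\<lambda>v. \<Sum>b\<in>B. ?H (e b) v *\<^sub>R b)) (at x)"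
    by (intro has_derivative_sum has_derivative_scaleR_left H)
  ultimately have X': "(?X has_derivative (\<lambda>v. \<Sum>b\<in>B. ?H (e b) v *\<^sub>R b)) (at x)"
    by simp
  moreover have "blinfun_apply \<mu> (\<Sum>b\<in>B. ?H (e b) v *\<^sub>R b) = ?H \<mu> v" for \<mu> v
  proof -
    \<comment> \<open>The coordinate formula only shows the Hessian along the functionals
      \<open>e b\<close>; for a general \<mu> it is identified by differentiating the pairing with
      \<mu> and using uniqueness of derivatives.\<close>
    have "((\<lambda>y. blinfun_apply \<mu> (?X y)) has_derivative
        (\<lambda>v. blinfun_apply \<mu> (\<Sum>b\<in>B. ?H (e b) v *\<^sub>R b))) (at x)"
      by (rule bounded_linear.has_derivative[OF blinfun.bounded_linear_right X'])
    from fun_cong[OF has_derivative_unique[OF this[unfolded ap] H]] show ?thesis .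
  qed
  ultimately show thesis by (rule that)
qed

context
  fixes bracket :: "'g::real_normed_vector \<Rightarrow> 'g \<Rightarrow> 'g"
  assumes lie: "lie_algebra bracket" and fd: "finite_dimensional TYPE('g)"
begin

lemma bilinear_bracket: "bilinear bracket"
  using lie by (simp add: lie_algebra_def)

lemma bounded_bilinear_bracket: "bounded_bilinear bracket"
  by (rule bounded_bilinear_finite_dimensional[OF fd fd bilinear_bracket])

lemma bracket_antisym: "bracket x y = - bracket y x"
proof -
  have z: "bracket z z = 0" for z using lie by (simp add: lie_algebra_def)
  have "bracket x y + bracket y x = 0"
    using z[of "x + y"]
    unfolding bilinear_ladd[OF bilinear_bracket] bilinear_radd[OF bilinear_bracket]
    by (simp add: z add.commute)
  then show ?thesis by (rule eq_neg_iff_add_eq_0[THEN iffD2])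
qed

lemma bilinear_lie_poisson:
  "bilinear (lie_poisson bracket \<mu>)"
proof -
  have i: "linear (inv bidual_embedding :: 'g dual dual \<Rightarrow> 'g)"
    by (rule linear_inv_bidual_embedding[OF fd])
  show ?thesis
    unfolding bilinear_def lie_poisson_def
    by (auto intro!: linearI simp: linear_add[OF i] linear_scale[OF i] blinfun.bilinear_simps
        bilinear_ladd[OF bilinear_bracket] bilinear_radd[OF bilinear_bracket]
        bilinear_lmul[OF bilinear_bracket] bilinear_rmul[OF bilinear_bracket])
qed

lemma smooth_bivector_field_lie_poisson: "smooth_bivector_field (lie_poisson bracket)"
proof -
  have "lie_poisson bracket \<mu> \<alpha> \<alpha> = 0" for \<mu> \<alpha>
    using lie by (simp add: lie_poisson_def lie_algebra_def)
  moreover have "smooth_on UNIV (\<lambda>\<mu>. lie_poisson bracket \<mu> \<alpha> \<beta>)" for \<alpha> \<beta>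
    unfolding lie_poisson_def by (intro smooth_on_bounded_linear blinfun.bounded_linear_left)
  ultimately show ?thesis using bilinear_lie_poisson by (simp add: smooth_bivector_field_def)
qed

text \<open>The transpose of \<open>ad X\<close> applied to \<mu>, without the minus sign of the
  coadjoint representation. If \<open>X\<close> represents the differential of \<open>f\<close> at
  \<mu>, this is the direction in which bracketing with \<open>f\<close> differentiates functions at
  \<mu>.\<close>

definition coadjoint :: "'g \<Rightarrow> 'g dual \<Rightarrow> 'g dual" where
  "coadjoint X \<mu> = \<mu> o\<^sub>L Blinfun (bracket X)"

lemma coadjoint_apply: "blinfun_apply (coadjoint X \<mu>) Y = blinfun_apply \<mu> (bracket X Y)"
  unfolding coadjoint_def
  by (simp add: bounded_linear_Blinfun_apply
      bounded_bilinear.bounded_linear_right[OF bounded_bilinear_bracket])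

text \<open>
  The Jacobi identity of the bracket accounts for the first-order part of the nested bracket;
  what remains is a difference of two Hessian terms, which cancels cyclically.
\<close>

lemma nested_poisson_bracket:
  fixes f g h :: "'g dual \<Rightarrow> real"
  assumes f: "smooth_on UNIV f" and g: "smooth_on UNIV g" and h: "smooth_on UNIV h"
  defines "X \<equiv> \<lambda>k x. inv bidual_embedding (differential k x)"
    and "H \<equiv> \<lambda>k x u v. frechet_derivative (\<lambda>y. frechet_derivative k (at y) u) (at x) v"
  shows "poisson_bracket (lie_poisson bracket) f (poisson_bracket (lie_poisson bracket) g h) x
    = blinfun_apply x (bracket (X f x) (bracket (X g x) (X h x)))
      + H h x (coadjoint (X g x) x) (coadjoint (X f x) x)
      - H g x (coadjoint (X h x) x) (coadjoint (X f x) x)"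
proof -
  let ?v = "coadjoint (X f x) x"
  let ?P = "poisson_bracket (lie_poisson bracket) g h"
  obtain G where G: "(X g has_derivative G) (at x)" "\<And>\<mu> v. blinfun_apply \<mu> (G v) = H g x \<mu> v"
    using inv_bidual_differential_has_derivative[OF fd g, of x] unfolding X_def H_def by metis
  obtain K where K: "(X h has_derivative K) (at x)" "\<And>\<mu> v. blinfun_apply \<mu> (K v) = H h x \<mu> v"
    using inv_bidual_differential_has_derivative[OF fd h, of x] unfolding X_def H_def by metis
  have P: "?P = (\<lambda>y. blinfun_apply y (bracket (X g y) (X h y)))"
    by (simp add: poisson_bracket_def lie_poisson_def X_def)
  \<comment> \<open>The product rule, once for the pairing of a functional with a vector and once
    for the Lie bracket inside it.\<close>
  have D: "(?P has_derivative (\<lambda>v. blinfun_apply x (bracket (X g x) (K v) + bracket (G v) (X h x))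
      + blinfun_apply v (bracket (X g x) (X h x)))) (at x)"
    unfolding P
    by (intro bounded_bilinear.FDERIV[OF bounded_bilinear_blinfun_apply]
        bounded_bilinear.FDERIV[OF bounded_bilinear_bracket] G(1) K(1) has_derivative_ident)
  have dP: "blinfun_apply (differential ?P x) = (\<lambda>v. blinfun_apply x (bracket (X g x) (K v) + bracket (G v) (X h x))
      + blinfun_apply v (bracket (X g x) (X h x)))"
    unfolding differential_def frechet_derivative_at[OF D, symmetric]
    by (rule bounded_linear_Blinfun_apply[OF has_derivative_bounded_linear[OF D]])
  \<comment> \<open>The outer bracket is the derivative of the inner one in the direction
    \<open>?v\<close>.\<close>
  have "poisson_bracket (lie_poisson bracket) f ?P x
      = blinfun_apply ?v (inv bidual_embedding (differential ?P x))"
    by (simp add: coadjoint_apply poisson_bracket_def[of _ f] lie_poisson_def X_def)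
  also have "\<dots> = blinfun_apply (differential ?P x) ?v"
    by (rule blinfun_apply_inv_bidual_embedding[OF fd])
  \<comment> \<open>Antisymmetry moves \<open>G ?v\<close> into the second slot, at the price of a
    sign, so that both second-order terms become pairings with coadjoint vectors, that is, Hessian
    values.\<close>
  also have "\<dots> = blinfun_apply (coadjoint (X g x) x) (K ?v) - blinfun_apply (coadjoint (X h x) x) (G ?v)
      + blinfun_apply x (bracket (X f x) (bracket (X g x) (X h x)))"
    unfolding dP using bracket_antisym[of "G ?v" "X h x"]
    by (simp add: coadjoint_apply blinfun.bilinear_simps)
  finally show ?thesis by (simp add: G(2) K(2))
qed

lemma poisson_manifold_lie_poisson: "poisson_manifold (lie_poisson bracket)"
proof -
  have "poisson_bracket (lie_poisson bracket) f (poisson_bracket (lie_poisson bracket) g h) x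
      + poisson_bracket (lie_poisson bracket) g (poisson_bracket (lie_poisson bracket) h f) x
      + poisson_bracket (lie_poisson bracket) h (poisson_bracket (lie_poisson bracket) f g) x = 0"
    if f: "smooth_on UNIV f" and g: "smooth_on UNIV g" and h: "smooth_on UNIV h"
    for f g h :: "'g dual \<Rightarrow> real" and x
  proof -
    define X where "X k = inv bidual_embedding (differential k x)" for k :: "'g dual \<Rightarrow> real"
    define w where "w k = coadjoint (X k) x" for k
    have "bracket (X f) (bracket (X g) (X h)) + bracket (X g) (bracket (X h) (X f))
        + bracket (X h) (bracket (X f) (X g)) = 0"
      using lie by (simp add: lie_algebra_def)
    then have "blinfun_apply x (bracket (X f) (bracket (X g) (X h)))
        + blinfun_apply x (bracket (X g) (bracket (X h) (X f)))
        + blinfun_apply x (bracket (X h) (bracket (X f) (X g))) = 0"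
      by (metis blinfun.add_right blinfun.zero_right)
    \<comment> \<open>In the cyclic sum each of the three Hessians occurs twice, with opposite signs
      and exchanged arguments \<open>w\<close>.\<close>
    then show ?thesis
      unfolding nested_poisson_bracket[OF f g h] nested_poisson_bracket[OF g h f]
        nested_poisson_bracket[OF h f g] X_def[symmetric] w_def[symmetric]
      using symmetric_second_derivative[OF f, of "w g" x "w h"]
        symmetric_second_derivative[OF g, of "w f" x "w h"]
        symmetric_second_derivative[OF h, of "w f" x "w g"]
      by linarith
  qed
  then show ?thesis
    unfolding poisson_manifold_def
    using finite_dimensional_dual[OF fd] smooth_bivector_field_lie_poisson by blast
qed


section \<open>The scaling action\<close>

text \<open>A linear map is its own tangent map, so each of the two covectors is multiplied by
  \<open>s\<close>. The base point stays \<open>x\<close> here; its rescaling is accounted for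
  separately by \<open>lie_poisson_scaleR\<close>.\<close>

lemma transport_scaling:
  "transport (\<lambda>\<mu>. s *\<^sub>R \<mu>) x (lie_poisson bracket) \<alpha> \<beta> = s * (s * lie_poisson bracket x \<alpha> \<beta>)"
proof -
  have b: "bounded_linear (\<lambda>\<mu>. s *\<^sub>R \<mu> :: 'g dual)" by (rule bounded_linear_scaleR_right)
  have "frechet_derivative (\<lambda>\<mu>. s *\<^sub>R \<mu> :: 'g dual) (at x) = (\<lambda>\<mu>. s *\<^sub>R \<mu>)"
    by (rule frechet_derivative_at[OF bounded_linear_imp_has_derivative[OF b], symmetric])
  then have "covector_pullback (\<lambda>\<mu>. s *\<^sub>R \<mu>) x \<alpha> = s *\<^sub>R \<alpha>" for \<alpha> :: "'g dual dual"
    unfolding covector_pullback_def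
    by (intro blinfun_eqI) (simp add: bounded_linear_Blinfun_apply[OF b] blinfun.bilinear_simps)
  then show ?thesis
    by (simp add: transport_def bilinear_lmul[OF bilinear_lie_poisson]
        bilinear_rmul[OF bilinear_lie_poisson])
qed

lemma lie_poisson_scaleR: "lie_poisson bracket (s *\<^sub>R \<mu>) \<alpha> \<beta> = s * lie_poisson bracket \<mu> \<alpha> \<beta>"
  by (simp add: lie_poisson_def blinfun.bilinear_simps)

lemma pushforward_scaling_lie_poisson:
  assumes "s > 0"
  shows "pushforward (scaling_action s) (lie_poisson bracket)
    = (\<lambda>\<mu> \<alpha> \<beta>. s * lie_poisson bracket \<mu> \<alpha> \<beta>)"
proof (intro ext)
  fix \<mu> :: "'g dual" and \<alpha> \<beta>
  have "scaling_action s = (\<lambda>\<mu> :: 'g dual. s *\<^sub>R \<mu>)" by (simp add: scaling_action_def fun_eq_iff)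
  moreover have "inv (\<lambda>\<mu> :: 'g dual. s *\<^sub>R \<mu>) \<mu> = inverse s *\<^sub>R \<mu>"
    using assms by (intro inv_f_eq injI) simp_all
  ultimately show "pushforward (scaling_action s) (lie_poisson bracket) \<mu> \<alpha> \<beta>
      = s * lie_poisson bracket \<mu> \<alpha> \<beta>"
    using assms by (simp add: pushforward_def transport_scaling lie_poisson_scaleR)
qed

lemma has_lie_derivative_lie_poisson:
  "has_lie_derivative (\<lambda>\<mu>. \<mu>) (lie_poisson bracket) x \<alpha> \<beta> (- lie_poisson bracket x \<alpha> \<beta>)"
proof -
  have "((\<lambda>t. exp t *\<^sub>R y) has_vector_derivative exp t *\<^sub>R y) (at t)" for t and y :: "'g dual"
    by (auto intro!: derivative_eq_intros)
  \<comment> \<open>The flow of the identity field is globally defined, so \<open>UNIV\<close>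
    serves as the neighbourhood and 1 is an arbitrary choice of time bound.\<close>
  then have "local_flow (\<lambda>\<mu> :: 'g dual. \<mu>) 1 UNIV (\<lambda>t \<mu>. exp t *\<^sub>R \<mu>)"
    unfolding local_flow_def using smooth_on_exp_scaleR by auto
  moreover have "transport (\<lambda>\<mu>. exp (- t) *\<^sub>R \<mu>) (exp t *\<^sub>R x) (lie_poisson bracket) \<alpha> \<beta>
      = exp (- t) * lie_poisson bracket x \<alpha> \<beta>" for t
    by (simp add: transport_scaling lie_poisson_scaleR exp_minus)
  moreover have "((\<lambda>t. exp (- t) * lie_poisson bracket x \<alpha> \<beta>)
      has_real_derivative - lie_poisson bracket x \<alpha> \<beta>) (at 0)"
    by (auto intro!: derivative_eq_intros)
  ultimately show ?thesis
    unfolding has_lie_derivative_def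
    by (intro exI[of _ "1::real"] exI[of _ UNIV] exI[of _ "\<lambda>t \<mu>. exp t *\<^sub>R \<mu>"]) simp
qed

end

lemma smooth_Rpos_action_scaling:
  "smooth_Rpos_action (scaling_action :: real \<Rightarrow> 'v::real_normed_vector \<Rightarrow> 'v)"
  unfolding smooth_Rpos_action_def scaling_action_def using smooth_on_scaleR by auto

lemma infinitesimal_generator_scaling:
  "infinitesimal_generator scaling_action = (\<lambda>\<mu> :: 'v::real_normed_vector. \<mu>)"
proof
  fix \<mu> :: 'v
  have "((\<lambda>t. exp t *\<^sub>R \<mu>) has_vector_derivative \<mu>) (at 0)"
    by (auto intro!: derivative_eq_intros)
  then show "infinitesimal_generator scaling_action \<mu> = \<mu>"
    unfolding infinitesimal_generator_def scaling_action_def by (rule vector_derivative_at)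
qed

theorem proposition5p1:
  fixes bracket :: "'g::real_normed_vector \<Rightarrow> 'g \<Rightarrow> 'g"
  assumes "lie_algebra bracket"
    and "finite_dimensional TYPE('g)"
  shows "(\<forall>\<mu> :: 'g dual. infinitesimal_generator scaling_action \<mu> = \<mu>) \<and>
    conformally_poisson scaling_action (lie_poisson bracket) 1 \<and>
    (\<forall>s>0. pushforward (scaling_action s) (lie_poisson bracket)
      = (\<lambda>\<mu> \<alpha> \<beta>. s * lie_poisson bracket \<mu> \<alpha> \<beta>)) \<and>
    exact_poisson_manifold (lie_poisson bracket) (infinitesimal_generator scaling_action)"
proof (intro conjI)
  show "\<forall>\<mu> :: 'g dual. infinitesimal_generator scaling_action \<mu> = \<mu>"
    by (simp add: infinitesimal_generator_scaling)
  show push: "\<forall>s>0. pushforward (scaling_action s) (lie_poisson bracket)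
      = (\<lambda>\<mu> \<alpha> \<beta>. s * lie_poisson bracket \<mu> \<alpha> \<beta>)"
    using pushforward_scaling_lie_poisson[OF assms] by blast
  \<comment> \<open>For degree 1 the factor \<open>s powr 1\<close> equals \<open>s\<close>, because
    \<open>s\<close> is positive.\<close>
  then show "conformally_poisson scaling_action (lie_poisson bracket) 1"
    by (simp add: conformally_poisson_def smooth_Rpos_action_scaling)
  show "exact_poisson_manifold (lie_poisson bracket) (infinitesimal_generator scaling_action)"
    unfolding exact_poisson_manifold_def infinitesimal_generator_scaling
    using poisson_manifold_lie_poisson[OF assms] has_lie_derivative_lie_poisson[OF assms]
      smooth_on_bounded_linear[OF bounded_linear_ident] by blast
qed

end
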